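(* Let $n,m\ge 1$, let $U_1,U_2,\dots,U_{n+m}$ be uniform $[0,1]$ random variables on a common probability space, and let $C$ be their $(n+m)$-copula. Let $\mathbf{U}$ denote the random vector $(U_1,\dots,U_n)$ and let $C_{\mathbf{U}}$ be its copula. If $n\ge 2$, suppose that $\lambda_n \ll V_{C_{\mathbf{U}}}\ll\lambda_n$ (where $\lambda_n$ is Lebesgue measure on $[0,1]^n$). Suppose that for each $i\in\{1,\dots,m\}$, $U_{n+i}$ is completely dependent on $\mathbf{U}$, i.e. there exist Borel functions $f_i\colon[0,1]^n\to[0,1]$ such that $U_{n+i}=f_i(\mathbf{U})$ almost surely. Then $$\operatorname{supp} C=\widehat{\operatorname{gr}\mathcal{F}^*}^{\,n},$$ the $n$-essential closure in $\mathbb{R}^{n+m}$ of the hypergraph of $\mathcal{F}^*$, where $\mathcal{F}^*=(f_1^*,\dots,f_m^* )$ is a Borel essential refinement of $\mathcal{F}=(f_1,\dots,f_m)$.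
   Context: A $k$-copula is a function $C\colon [0,1]^k \to [0,1]$ such that (i) $C(u_1,\dots,u_{i-1},0,u_{i+1},\dots,u_k)=0$; (ii) $C(1,\dots,1,u_i,1,\dots,1)=u_i$; (iii) $C$ is $k$-increasing: for each hyperrectangle $B=\prod_{i=1}^k [x_i,y_i]\subseteq[0,1]^k$, $V_C(B)=\sum_{z\in\prod_{i=1}^k\{x_i,y_i\}}(-1)^{N(z)}C(z)\ge 0$, where $N(z)$ is the size of $\{i\colon z_i=x_i\}$. The set function $V_C$ extends uniquely to a Borel probability measure on $[0,1]^k$, also denoted $V_C$. The support $\operatorname{supp} C$ is the topological support of the measure $V_C$. The copula of uniform $[0,1]$ random variables is their joint distribution function on $[0,1]^k$, so $V_C$ is their joint law. A standard subspace of $\mathbb{R}^k$ is a subspace spanned by standard basis vectors. $\lambda_d$ and $\lambda_d^*$ denote $d$-dimensional Lebesgue measure and outer measure (a $d$-dimensional standard subspace being identified with $\mathbb{R}^d$), with $\lambda_0=\lambda_0^*$ the counting measure. $\pi_W$ is the orthogonal projection onto $W$, and $\pi_j$ is the orthogonal projection onto the $j$-th axis. For $A\subseteq\mathbb{R}^k$ and an integer $0\le d\le k$, the $d$-essential closure $\widehat{A}^{d}$ of $A$ is the set of all $x\in\mathbb{R}^k$ such that for every open neighborhood $G$ of $x$ there exists a $d$-dimensional standard subspace $W$ with $\lambda_d^*(\pi_W(G\cap A))>0$. For a tuple $\mathcal{F}=(f_1,\dots,f_m)$ of functions from $D$ into $R$, the hypergraph is $\operatorname{gr}\mathcal{F}=\{(x,f_1(x),\dots,f_m(x))\in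 D\times R^m\colon x\in D\}$. For $\mathcal{F}\colon[0,1]^n\to[0,1]^m$ with Borel coordinate functions, a Borel essential refinement of $\mathcal{F}$ is a function $\mathcal{F}^*\colon[0,1]^n\to[0,1]^m$ with Borel coordinate functions such that each corresponding pair of coordinate functions of $\mathcal{F}^*$ and $\mathcal{F}$ are equal ($\lambda_n$-)almost everywhere and, for any open set $G\subseteq\mathbb{R}^{n+m}$, $\lambda_n(\pi_{W_0}(G\cap\operatorname{gr}\mathcal{F}^* ))=0$ implies $\lambda_1(\pi_j(G\cap\operatorname{gr}\mathcal{F}^* ))=0$ for all $j>n$ ($n<j\le n+m$), where $W_0\subseteq\mathbb{R}^{n+m}$ is the subspace spanned by the first $n$ standard basis vectors. (All projections of Borel sets occurring here are Lebesgue measurable.) *)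

theory Defs
  imports "HOL-Probability.Probability"
begin

definition unit_cube :: "(real ^ 'k) set" where
  "unit_cube = {u. \<forall>i. 0 \<le> u $ i \<and> u $ i \<le> 1}"

(* The vertices form a set of 2^k points only for a nondegenerate rectangle
   (x $ i < y $ i for all i); the volume is used for those only.  A degenerate
   rectangle would contribute collapsed vertices with the wrong sign. *)
definition copula_volume :: "(real ^ 'k \<Rightarrow> real) \<Rightarrow> real ^ 'k \<Rightarrow> real ^ 'k \<Rightarrow> real" where
  "copula_volume C x y =
     (\<Sum>z\<in>{z. \<forall>i. z $ i \<in> {x $ i, y $ i}}. (-1) ^ card {i. z $ i = x $ i} * C z)"

definition is_copula :: "(real ^ 'k \<Rightarrow> real) \<Rightarrow> bool" where
  "is_copula C \<longleftrightarrow>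
     (\<forall>u\<in>unit_cube. 0 \<le> C u \<and> C u \<le> 1) \<and>
     (\<forall>u\<in>unit_cube. (\<exists>i. u $ i = 0) \<longrightarrow> C u = 0) \<and>
     (\<forall>u\<in>unit_cube. \<forall>i. (\<forall>j. j \<noteq> i \<longrightarrow> u $ j = 1) \<longrightarrow> C u = u $ i) \<and>
     (\<forall>x\<in>unit_cube. \<forall>y\<in>unit_cube. (\<forall>i. x $ i < y $ i) \<longrightarrow> 0 \<le> copula_volume C x y)"

definition extends_copula_volume :: "(real ^ 'k \<Rightarrow> real) \<Rightarrow> (real ^ 'k) measure \<Rightarrow> bool" where
  "extends_copula_volume C M \<longleftrightarrow>
     prob_space M \<and>
     space M = unit_cube \<and> sets M = sets (restrict_space borel unit_cube) \<and>
     (\<forall>x\<in>unit_cube. \<forall>y\<in>unit_cube. (\<forall>i. x $ i < y $ i) \<longrightarrow>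
        measure M (cbox x y) = copula_volume C x y)"

definition copula_measure :: "(real ^ 'k \<Rightarrow> real) \<Rightarrow> (real ^ 'k) measure" where
  "copula_measure C = (THE M. extends_copula_volume C M)"

definition copula_support :: "(real ^ 'k \<Rightarrow> real) \<Rightarrow> (real ^ 'k) set" where
  "copula_support C =
     {x \<in> unit_cube. \<forall>G. open G \<and> x \<in> G \<longrightarrow> 0 < emeasure (copula_measure C) (G \<inter> unit_cube)}"

definition uniform01_rv :: "'a measure \<Rightarrow> ('a \<Rightarrow> real) \<Rightarrow> bool" where
  "uniform01_rv P X \<longleftrightarrow>
     X \<in> borel_measurable P \<and> distr P borel X = uniform_measure lborel {0..1}"

(* The joint distribution function on the cube; a copula when the U k are
   uniform on [0,1], see is_copula_copula_of below. *)
definition copula_of :: "'a measure \<Rightarrow> ('k \<Rightarrow> 'a \<Rightarrow> real) \<Rightarrow> real ^ 'k \<Rightarrow> real" where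
  "copula_of P U = (\<lambda>u\<in>unit_cube. measure P {\<omega> \<in> space P. \<forall>k. U k \<omega> \<le> u $ k})"

definition standard_subspace :: "'a::euclidean_space set \<Rightarrow> bool" where
  "standard_subspace W \<longleftrightarrow> (\<exists>B\<subseteq>Basis. W = span B)"

definition orth_proj :: "'a::euclidean_space set \<Rightarrow> 'a \<Rightarrow> 'a" where
  "orth_proj W x = (THE p. p \<in> W \<and> (\<forall>w\<in>W. orthogonal (x - p) w))"

(* For a standard subspace W of dimension d: d-dimensional Lebesgue measure on W,
   as a Borel measure on the ambient space that is concentrated on W, built like
   lborel itself.  For W = {0} it is the Dirac measure at 0, which agrees with
   counting measure on subsets of W. *)
definition subspace_lborel :: "'a::euclidean_space set \<Rightarrow> 'a measure" where
  "subspace_lborel W =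
     distr (\<Pi>\<^sub>M b\<in>Basis \<inter> W. lborel) borel (\<lambda>f. \<Sum>b\<in>Basis \<inter> W. f b *\<^sub>R b)"

definition subspace_outer :: "'a::euclidean_space set \<Rightarrow> 'a set \<Rightarrow> ennreal" where
  "subspace_outer W A = outer_measure_of (subspace_lborel W) A"

definition essential_closure :: "nat \<Rightarrow> 'a::euclidean_space set \<Rightarrow> 'a set" where
  "essential_closure d A =
     {x. \<forall>G. open G \<and> x \<in> G \<longrightarrow>
        (\<exists>W. standard_subspace W \<and> dim W = d \<and> 0 < subspace_outer W (orth_proj W ` (G \<inter> A)))}"

(* R^(n+m) is real ^ ('n + 'm): the first n coordinates are the Inl i, the
   last m coordinates are the Inr j. *)
definition hypergraph ::
    "(real ^ 'n) set \<Rightarrow> ('m::finite \<Rightarrow> real ^ 'n \<Rightarrow> real) \<Rightarrow> (real ^ ('n + 'm)) set" where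
  "hypergraph D f = (\<lambda>x. \<chi> k. case k of Inl i \<Rightarrow> x $ i | Inr j \<Rightarrow> f j x) ` D"

definition borel_on_cube :: "(real ^ 'n \<Rightarrow> real) \<Rightarrow> bool" where
  "borel_on_cube g \<longleftrightarrow>
     g \<in> restrict_space borel unit_cube \<rightarrow>\<^sub>M restrict_space borel {0..1}"

(* Outer measure agrees with Lebesgue measure on Lebesgue measurable sets, and the
   projections below (a Borel set and an analytic set) are Lebesgue measurable. *)
definition borel_essential_refinement ::
    "('m::finite \<Rightarrow> real ^ 'n \<Rightarrow> real) \<Rightarrow> ('m \<Rightarrow> real ^ 'n \<Rightarrow> real) \<Rightarrow> bool" where
  "borel_essential_refinement f f' \<longleftrightarrow>
     (\<forall>j. borel_on_cube (f' j)) \<and>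
     (\<forall>j. AE x in lborel. x \<in> unit_cube \<longrightarrow> f' j x = f j x) \<and>
     (\<forall>G :: (real ^ ('n + 'm)) set. open G \<longrightarrow>
        (let W0 = span (range (\<lambda>i. axis (Inl i) 1)) in
           subspace_outer W0 (orth_proj W0 ` (G \<inter> hypergraph unit_cube f')) = 0) \<longrightarrow>
        (\<forall>j. let Wj = span {axis (Inr j) 1} in
           subspace_outer Wj (orth_proj Wj ` (G \<inter> hypergraph unit_cube f')) = 0))"

lemma orth_proj_span_Basis:
  fixes x :: "'a::euclidean_space"
  assumes "B \<subseteq> Basis"
  shows "orth_proj (span B) x = (\<Sum>b\<in>B. (x \<bullet> b) *\<^sub>R b)"
proof -
  have fin: "finite B" using assms finite_Basis finite_subset by blast
  define p where "p = (\<Sum>b\<in>B. (x \<bullet> b) *\<^sub>R b)"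
  have p: "p \<in> span B" unfolding p_def by (intro span_sum span_scale span_base)
  have pb: "p \<bullet> b = x \<bullet> b" if "b \<in> B" for b
  proof -
    have "p \<bullet> b = (\<Sum>c\<in>B. (x \<bullet> c) * (c \<bullet> b))"
      unfolding p_def by (simp add: inner_sum_left)
    also have "\<dots> = (\<Sum>c\<in>B. if c = b then x \<bullet> b else 0)"
    proof (rule sum.cong[OF refl])
      fix c assume "c \<in> B"
      with assms that have "c \<bullet> b = (if c = b then 1 else 0)" by (intro inner_Basis) auto
      then show "(x \<bullet> c) * (c \<bullet> b) = (if c = b then x \<bullet> b else 0)" by (simp split: if_splits)
    qed
    also have "\<dots> = x \<bullet> b" using fin that by simp
    finally show ?thesis .
  qed
  have orth: "\<forall>w\<in>span B. orthogonal (x - p) w"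
    
  proof
    fix w assume w: "w \<in> span B"
    show "orthogonal (x - p) w"
      by (rule orthogonal_to_span[OF w]) (simp add: orthogonal_def inner_diff_left pb)
  qed
  show ?thesis
    unfolding orth_proj_def p_def[symmetric]
  proof (rule the_equality)
    show "p \<in> span B \<and> (\<forall>w\<in>span B. orthogonal (x - p) w)" using p orth by simp
  next
    fix q assume q: "q \<in> span B \<and> (\<forall>w\<in>span B. orthogonal (x - q) w)"
    have d: "q - p \<in> span B" using p q by (intro span_diff) auto
    have "(x - p) \<bullet> (q - p) = 0" "(x - q) \<bullet> (q - p) = 0"
      using orth q d unfolding orthogonal_def by blast+
    moreover have "(q - p) \<bullet> (q - p) = (x - p) \<bullet> (q - p) - (x - q) \<bullet> (q - p)"
      unfolding inner_diff_left by linarith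
    ultimately have "(q - p) \<bullet> (q - p) = 0" by simp
    then show "q = p" by simp
  qed
qed

lemma unit_cube_eq_cbox: "unit_cube = cbox 0 (1 :: real ^ 'k)"
  by (auto simp: unit_cube_def mem_box_cart)

lemma zero_in_unit_cube: "0 \<in> unit_cube"
  by (simp add: unit_cube_def)

lemma cbox_subset_unit_cube:
  assumes "x \<in> unit_cube" "y \<in> unit_cube"
  shows "cbox x y \<subseteq> unit_cube"
proof
  fix z assume z: "z \<in> cbox x y"
  have "0 \<le> z $ i \<and> z $ i \<le> 1" for i
  proof -
    have "0 \<le> x $ i" "y $ i \<le> 1" "x $ i \<le> z $ i" "z $ i \<le> y $ i"
      using assms z by (auto simp: unit_cube_def mem_box_cart)
    then show ?thesis by linarith
  qed
  then show "z \<in> unit_cube" by (simp add: unit_cube_def)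
qed

lemma extends_copula_volume_unique:
  assumes M: "extends_copula_volume C M" and N: "extends_copula_volume C N"
  shows "M = N"
proof -
  have sets_eq: "sets M = sets N" using M N by (simp add: extends_copula_volume_def)
  have cb: "unit_cube \<in> sets (borel :: (real ^ 'a) measure)" by (simp add: unit_cube_eq_cbox)
  define pt :: "real ^ 'a \<Rightarrow> nat \<Rightarrow> real ^ 'a"
    where "pt a n = (\<chi> i. min 1 (max (a $ i) (1 / real (Suc n))))" for a n
  have lim: "(\<lambda>n. copula_volume C 0 (pt a n)) \<longlonglongrightarrow> measure Q ({..a} \<inter> unit_cube)"
    if Q: "extends_copula_volume C Q" and a: "\<And>i. 0 \<le> a $ i" for a Q
  proof -
    interpret Q: prob_space Q using Q by (simp add: extends_copula_volume_def)
    have sQ: "sets Q = sets (restrict_space borel unit_cube)"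
      using Q by (simp add: extends_copula_volume_def)
    have pt: "pt a n \<in> unit_cube" "\<And>i. 0 < pt a n $ i" for n
      using a by (auto simp: pt_def unit_cube_def min_less_iff_conj less_max_iff_disj le_max_iff_disj)
    have sub: "cbox 0 (pt a n) \<subseteq> unit_cube" for n
      using pt(1)[of n] by (rule cbox_subset_unit_cube[OF zero_in_unit_cube])
    have inS: "cbox 0 (pt a n) \<in> sets Q" for n
      using sub[of n] cb by (simp add: sQ sets_restrict_space_iff)
    have eq: "measure Q (cbox 0 (pt a n)) = copula_volume C 0 (pt a n)" for n
      using Q pt[of n] by (auto simp: extends_copula_volume_def unit_cube_def)
    have dec: "decseq (\<lambda>n. cbox 0 (pt a n))"
    proof (rule decseq_SucI)
      fix n
      have "pt a (Suc n) $ i \<le> pt a n $ i" for i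
      proof -
        have "1 / real (Suc (Suc n)) \<le> 1 / real (Suc n)" by (simp add: frac_le)
        then show ?thesis unfolding pt_def vec_lambda_beta by (intro min.mono max.mono order_refl)
      qed
      then show "cbox 0 (pt a (Suc n)) \<subseteq> cbox 0 (pt a n)"
        unfolding subset_iff mem_box_cart by (blast intro: order_trans)
    qed
    have int: "(\<Inter>n. cbox 0 (pt a n)) = {..a} \<inter> unit_cube"
    proof (rule set_eqI, rule iffI)
      fix x assume x: "x \<in> (\<Inter>n. cbox 0 (pt a n))"
      then have x': "0 \<le> x $ i" "x $ i \<le> pt a n $ i" for i n by (auto simp: mem_box_cart)
      have "x $ i \<le> 1" for i using x'(2)[of i 0] by (simp add: pt_def)
      moreover have "x $ i \<le> a $ i" for i
      proof (rule LIMSEQ_le_const)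
        have "(\<lambda>n. max (a $ i) (1 / real (Suc n))) \<longlonglongrightarrow> max (a $ i) 0"
          using LIMSEQ_inverse_real_of_nat
          by (intro tendsto_max tendsto_const) (simp add: inverse_eq_divide)
        then show "(\<lambda>n. max (a $ i) (1 / real (Suc n))) \<longlonglongrightarrow> a $ i"
          using a[of i] by (simp add: max_def)
        show "\<exists>N. \<forall>n\<ge>N. x $ i \<le> max (a $ i) (1 / real (Suc n))"
          using x'(2)[of i] by (simp add: pt_def)
      qed
      ultimately show "x \<in> {..a} \<inter> unit_cube"
        using x'(1) by (auto simp: unit_cube_def less_eq_vec_def)
    next
      fix x assume "x \<in> {..a} \<inter> unit_cube"
      then show "x \<in> (\<Inter>n. cbox 0 (pt a n))"
        by (auto simp: mem_box_cart unit_cube_def less_eq_vec_def pt_def le_max_iff_disj)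
    qed
    have "(\<lambda>n. measure Q (cbox 0 (pt a n))) \<longlonglongrightarrow> measure Q (\<Inter>n. cbox 0 (pt a n))"
      using inS dec by (intro Q.finite_Lim_measure_decseq) auto
    then show ?thesis by (simp add: eq int)
  qed
  have agree: "measure M ({..a} \<inter> unit_cube) = measure N ({..a} \<inter> unit_cube)" for a :: "real ^ 'a"
  proof (cases "\<forall>i. 0 \<le> a $ i")
    case True
    then show ?thesis using lim[OF M] lim[OF N] LIMSEQ_unique by blast
  next
    case False
    then obtain i where "a $ i < 0" by (auto simp: not_le)
    have "x \<notin> unit_cube" if "x \<le> a" for x
    proof -
      have "x $ i \<le> a $ i" using that by (simp add: less_eq_vec_def)
      with \<open>a $ i < 0\<close> have "\<not> 0 \<le> x $ i" by linarith
      then show ?thesis unfolding unit_cube_def by blast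
    qed
    then have "{..a} \<inter> unit_cube = {}" by auto
    then show ?thesis by simp
  qed
  interpret M: prob_space M using M by (simp add: extends_copula_volume_def)
  interpret N: prob_space N using N by (simp add: extends_copula_volume_def)
  have sM: "space M = unit_cube" "sets M = sets (restrict_space borel unit_cube)"
    and sN: "space N = unit_cube" "sets N = sets (restrict_space borel unit_cube)"
    using M N by (auto simp: extends_copula_volume_def)
  have idM: "(\<lambda>x. x) \<in> M \<rightarrow>\<^sub>M borel" and idN: "(\<lambda>x. x) \<in> N \<rightarrow>\<^sub>M borel"
    unfolding measurable_cong_sets[OF sM(2) refl] measurable_cong_sets[OF sN(2) refl]
    by (auto intro: measurable_restrict_space1)
  have "distr M borel (\<lambda>x. x) = distr N borel (\<lambda>x. x)"
  proof (rule measure_eqI_generator_eq)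
    let ?E = "range (\<lambda>a. {..a :: real ^ 'a})"
    show "Int_stable ?E"
    proof (rule Int_stableI)
      fix A B assume "A \<in> ?E" "B \<in> ?E"
      then obtain a b where "A = {..a}" "B = {..b}" by blast
      then have "A \<inter> B = {..inf a b}" by auto
      then show "A \<inter> B \<in> ?E" by blast
    qed
    show "?E \<subseteq> Pow UNIV" by simp
    show "sets (distr M borel (\<lambda>x. x)) = sigma_sets UNIV ?E"
      "sets (distr N borel (\<lambda>x. x)) = sigma_sets UNIV ?E"
      unfolding sets_distr borel_eq_atMost by (rule sets_measure_of, simp)+
    show "emeasure (distr M borel (\<lambda>x. x)) X = emeasure (distr N borel (\<lambda>x. x)) X"
      if "X \<in> ?E" for X
    proof -
      from that obtain a where X: "X = {..a}" by blast
      have "emeasure (distr M borel (\<lambda>x. x)) {..a} = measure M ({..a} \<inter> unit_cube)"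
        using emeasure_distr[OF idM, of "{..a}"] by (simp add: sM(1) M.emeasure_eq_measure)
      moreover have "emeasure (distr N borel (\<lambda>x. x)) {..a} = measure N ({..a} \<inter> unit_cube)"
        using emeasure_distr[OF idN, of "{..a}"] by (simp add: sN(1) N.emeasure_eq_measure)
      ultimately show ?thesis by (simp only: X agree)
    qed
    show "range (\<lambda>n. {..(\<chi> i. real n) :: real ^ 'a}) \<subseteq> ?E" by auto
    show "(\<Union>n. {..(\<chi> i. real n) :: real ^ 'a}) = UNIV"
    proof (intro equalityI subset_UNIV subsetI)
      fix x :: "real ^ 'a"
      obtain n where n: "(MAX i. x $ i) \<le> real n" using real_arch_simple by blast
      have "x $ i \<le> real n" for i
        using n Max_ge[of "range (\<lambda>i. x $ i)" "x $ i"] by auto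
      then show "x \<in> (\<Union>n. {..(\<chi> i. real n) :: real ^ 'a})"
        by (auto simp: less_eq_vec_def)
    qed
    show "emeasure (distr M borel (\<lambda>x. x)) {..(\<chi> i. real n) :: real ^ 'a} \<noteq> \<infinity>" for n
      using emeasure_distr[OF idM, of "{..(\<chi> i. real n)}"] by (simp add: M.emeasure_eq_measure)
  qed
  then have *: "emeasure (distr M borel (\<lambda>x. x)) A = emeasure (distr N borel (\<lambda>x. x)) A" for A
    by simp
  show ?thesis
  proof (rule measure_eqI[OF sets_eq])
    fix A assume "A \<in> sets M"
    then have A: "A \<subseteq> unit_cube" "A \<in> sets borel"
      using cb by (auto simp: sM sets_restrict_space_iff)
    then have "(\<lambda>x. x) -` A \<inter> unit_cube = A" by auto
    with * emeasure_distr[OF idM A(2)] emeasure_distr[OF idN A(2)]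
    show "emeasure M A = emeasure N A" by (simp only: sM(1) sN(1))
  qed
qed

lemma copula_measure_eqI: "extends_copula_volume C M \<Longrightarrow> copula_measure C = M"
  unfolding copula_measure_def
  by (rule the_equality, assumption, erule extends_copula_volume_unique)

lemma copula_volume_eq_sum_Pow:
  fixes x y :: "real ^ 'k"
  assumes "\<And>i. x $ i < y $ i"
  shows "copula_volume C x y =
    (\<Sum>S\<in>UNIV. (-1) ^ card S * C (\<chi> i. if i \<in> S then x $ i else y $ i))"
  unfolding copula_volume_def
proof (rule sum.reindex_bij_witness[where i = "\<lambda>S. \<chi> i. if i \<in> S then x $ i else y $ i"
      and j = "\<lambda>z. {i. z $ i = x $ i}"])
  fix z assume z: "z \<in> {z. \<forall>i. z $ i \<in> {x $ i, y $ i}}"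
  then show 1: "(\<chi> i. if i \<in> {i. z $ i = x $ i} then x $ i else y $ i) = z"
    by (auto simp: vec_eq_iff)
  then show "(-1) ^ card {i. z $ i = x $ i} * C (\<chi> i. if i \<in> {i. z $ i = x $ i} then x $ i else y $ i)
    = (-1) ^ card {i. z $ i = x $ i} * C z" by simp
next
  fix S :: "'k set"
  show "{i. (\<chi> i. if i \<in> S then x $ i else y $ i) $ i = x $ i} = S"
  proof (rule set_eqI)
    fix i
    show "i \<in> {i. (\<chi> i. if i \<in> S then x $ i else y $ i) $ i = x $ i} \<longleftrightarrow> i \<in> S"
      using assms[of i] by auto
  qed
qed auto

context
  fixes P :: "'a measure" and U :: "'k::finite \<Rightarrow> 'a \<Rightarrow> real"
  assumes P: "prob_space P" and U: "\<And>k. uniform01_rv P (U k)"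
begin

interpretation P: prob_space P by (rule P)

lemma uniform_measurable [measurable]: "U k \<in> borel_measurable P"
  using U by (simp add: uniform01_rv_def)

lemma uniform_emeasure:
  assumes "A \<in> sets borel"
  shows "emeasure P {\<omega> \<in> space P. U k \<omega> \<in> A} = emeasure lborel ({0..1} \<inter> A)"
proof -
  have "emeasure (distr P borel (U k)) A = emeasure (uniform_measure lborel {0..1}) A"
    using U by (simp add: uniform01_rv_def)
  then show ?thesis
    using assms by (simp add: emeasure_distr vimage_def Int_def conj_commute divide_ennreal_def)
qed

lemma uniform_AE: "AE \<omega> in P. \<forall>k. U k \<omega> \<in> {0..1}"
proof -
  have "AE \<omega> in P. U k \<omega> \<in> {0..1}" for k
  proof -
    have "measure P {\<omega> \<in> space P. U k \<omega> \<in> {0..1}} = 1"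
      using uniform_emeasure[of "{0..1}" k] by (simp add: measure_def)
    then have "AE \<omega> in P. \<omega> \<in> {\<omega> \<in> space P. U k \<omega> \<in> {0..1}}" by (rule P.AE_prob_1)
    then show ?thesis by eventually_elim simp
  qed
  then show ?thesis by (subst AE_all_countable) simp
qed

lemma uniform_AE_neq: "AE \<omega> in P. \<forall>k. U k \<omega> \<noteq> c k"
proof -
  have "AE \<omega> in P. U k \<omega> \<noteq> c k" for k
  proof (rule AE_I)
    show "{\<omega> \<in> space P. \<not> U k \<omega> \<noteq> c k} \<subseteq> {\<omega> \<in> space P. U k \<omega> \<in> {c k}}" by auto
    have "emeasure lborel ({0..1} \<inter> {c k}) \<le> emeasure lborel {c k}"
      by (intro emeasure_mono) auto
    then show "emeasure P {\<omega> \<in> space P. U k \<omega> \<in> {c k}} = 0"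
      using uniform_emeasure[of "{c k}" k] by simp
  qed measurable
  then show ?thesis by (subst AE_all_countable) simp
qed

lemma joint_measurable: "(\<lambda>\<omega>. \<chi> k. U k \<omega>) \<in> borel_measurable P"
  by (subst borel_measurable_euclidean_space)
    (auto simp: Basis_vec_def inner_axis)

lemma joint_cdf_box:
  "(\<Sum>S\<in>UNIV. (-1) ^ card S * measure P {\<omega> \<in> space P. \<forall>k. U k \<omega> \<le> (if k \<in> S then x $ k else y $ k)})
    = measure P {\<omega> \<in> space P. \<forall>k. x $ k \<le> U k \<omega> \<and> U k \<omega> \<le> y $ k}" (is "?l = ?r")
  if xy: "\<And>k. x $ k < y $ k" for x y :: "real ^ 'k"
proof -
  define g where "g t v = (if v \<le> t then 1 else 0 :: real)" for t v :: real
  have [measurable]: "g t \<in> borel_measurable borel" for t unfolding g_def by measurable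
  have prod_g: "(\<Prod>k\<in>UNIV. g (t k) (U k \<omega>)) = indicator {\<omega> \<in> space P. \<forall>k. U k \<omega> \<le> t k} \<omega>"
    if "\<omega> \<in> space P" for t \<omega>
  proof (cases "\<forall>k. U k \<omega> \<le> t k")
    case True
    then show ?thesis using that by (simp add: g_def)
  next
    case False
    then obtain k where "g (t k) (U k \<omega>) = 0" by (auto simp: g_def)
    then have "(\<Prod>k\<in>UNIV. g (t k) (U k \<omega>)) = 0" by (intro prod_zero) auto
    with False show ?thesis by simp
  qed
  have split: "(\<Prod>k\<in>S. g (x $ k) (U k \<omega>)) * (\<Prod>k\<in>UNIV-S. g (y $ k) (U k \<omega>)) =
      (\<Prod>k\<in>UNIV. g (if k \<in> S then x $ k else y $ k) (U k \<omega>))" for S \<omega>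
  proof -
    let ?h = "\<lambda>k. g (if k \<in> S then x $ k else y $ k) (U k \<omega>)"
    have "prod ?h UNIV = prod ?h (UNIV - S) * prod ?h S"
      by (rule prod.subset_diff) auto
    also have "prod ?h S = (\<Prod>k\<in>S. g (x $ k) (U k \<omega>))" by (intro prod.cong) auto
    also have "prod ?h (UNIV - S) = (\<Prod>k\<in>UNIV-S. g (y $ k) (U k \<omega>))" by (intro prod.cong) auto
    finally show ?thesis by (simp only: mult.commute)
  qed
  have diff: "(\<Prod>k\<in>UNIV. g (y $ k) (U k \<omega>) - g (x $ k) (U k \<omega>)) =
      (\<Sum>S\<in>UNIV. (-1) ^ card S * indicator {\<omega> \<in> space P. \<forall>k. U k \<omega> \<le> (if k \<in> S then x $ k else y $ k)} \<omega>)"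
    if "\<omega> \<in> space P" for \<omega>
    unfolding prod_diff_conv_sum[OF finite] mult.assoc split prod_g[OF that] by simp
  have m: "{\<omega> \<in> space P. \<forall>k. U k \<omega> \<le> t k} \<in> sets P" for t by measurable
  have ind: "(\<integral>\<omega>. indicator A \<omega> \<partial>P) = measure P A" if "A \<in> sets P" for A
    using that by (simp only: Bochner_Integration.integral_indicator sets.Int_space_eq2)
  have int: "integrable P (indicator A :: _ \<Rightarrow> real)" if "A \<in> sets P" for A
    using that by (simp add: P.emeasure_eq_measure)
  have "?l = (\<Sum>S\<in>UNIV. (-1) ^ card S * (\<integral>\<omega>. indicator {\<omega> \<in> space P. \<forall>k. U k \<omega> \<le> (if k \<in> S then x $ k else y $ k)} \<omega> \<partial>P))"
    unfolding ind[OF m] ..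
  also have "\<dots> = (\<integral>\<omega>. (\<Sum>S\<in>UNIV. (-1) ^ card S * indicator {\<omega> \<in> space P. \<forall>k. U k \<omega> \<le> (if k \<in> S then x $ k else y $ k)} \<omega>) \<partial>P)"
    by (subst Bochner_Integration.integral_sum)
      (simp_all only: integral_mult_right_zero, intro integrable_mult_right int m)
  also have "\<dots> = (\<integral>\<omega>. (\<Prod>k\<in>UNIV. g (y $ k) (U k \<omega>) - g (x $ k) (U k \<omega>)) \<partial>P)"
    by (intro Bochner_Integration.integral_cong refl diff[symmetric])
  also have "\<dots> = (\<integral>\<omega>. indicator {\<omega> \<in> space P. \<forall>k. x $ k \<le> U k \<omega> \<and> U k \<omega> \<le> y $ k} \<omega> \<partial>P)"
  proof (rule integral_cong_AE)
    show "AE \<omega> in P. (\<Prod>k\<in>UNIV. g (y $ k) (U k \<omega>) - g (x $ k) (U k \<omega>)) =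
      indicator {\<omega> \<in> space P. \<forall>k. x $ k \<le> U k \<omega> \<and> U k \<omega> \<le> y $ k} \<omega>"
      using uniform_AE_neq[of "\<lambda>k. x $ k"] AE_space
    proof eventually_elim
      case (elim \<omega>)
      have k: "g (y $ k) (U k \<omega>) - g (x $ k) (U k \<omega>) = (if x $ k \<le> U k \<omega> \<and> U k \<omega> \<le> y $ k then 1 else 0)" for k
        using elim(1)[rule_format, of k] xy[of k] by (auto simp: g_def)
      show ?case
      proof (cases "\<forall>k. x $ k \<le> U k \<omega> \<and> U k \<omega> \<le> y $ k")
        case True
        then show ?thesis using elim by (simp add: k)
      next
        case False
        then have "(\<Prod>k\<in>UNIV. g (y $ k) (U k \<omega>) - g (x $ k) (U k \<omega>)) = 0"
          by (intro prod_zero) (auto simp: k)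
        with False show ?thesis by simp
      qed
    qed
  qed measurable
  also have "\<dots> = ?r" by (simp add: Int_absorb1)
  finally show ?thesis .
qed

lemma copula_of_box:
  fixes x y :: "real ^ 'k"
  assumes x: "x \<in> unit_cube" and y: "y \<in> unit_cube" and xy: "\<And>i. x $ i < y $ i"
  shows "copula_volume (copula_of P U) x y =
    measure P {\<omega> \<in> space P. \<forall>k. x $ k \<le> U k \<omega> \<and> U k \<omega> \<le> y $ k}"
proof -
  have "(\<chi> i. if i \<in> S then x $ i else y $ i) \<in> unit_cube" for S
    using x y by (auto simp: unit_cube_def)
  then show ?thesis
    using joint_cdf_box[OF xy] by (simp add: copula_volume_eq_sum_Pow[OF xy] copula_of_def)
qed

lemma copula_measure_copula_of:
  "copula_measure (copula_of P U) = restrict_space (distr P borel (\<lambda>\<omega>. \<chi> k. U k \<omega>)) unit_cube"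
proof (rule copula_measure_eqI)
  let ?D = "distr P borel (\<lambda>\<omega>. \<chi> k. U k \<omega>)"
  note joint_measurable [measurable]
  have cb: "unit_cube \<in> sets (borel :: (real ^ 'k) measure)" by (simp add: unit_cube_eq_cbox)
  interpret D: prob_space ?D by (rule P.prob_space_distr) measurable
  have "AE v in ?D. v \<in> unit_cube"
    using uniform_AE cb by (subst AE_distr_iff) (auto simp: unit_cube_def)
  then have 1: "emeasure ?D unit_cube = 1"
    using cb D.emeasure_eq_1_AE[of unit_cube] by simp
  have box: "measure (restrict_space ?D unit_cube) (cbox x y) = copula_volume (copula_of P U) x y"
    if "x \<in> unit_cube" "y \<in> unit_cube" "\<forall>i. x $ i < y $ i" for x y
  proof -
    have "cbox x y \<subseteq> unit_cube" using that by (intro cbox_subset_unit_cube)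
    then have "measure (restrict_space ?D unit_cube) (cbox x y) = measure ?D (cbox x y)"
      using cb by (intro measure_restrict_space) auto
    also have "\<dots> = measure P {\<omega> \<in> space P. \<forall>k. x $ k \<le> U k \<omega> \<and> U k \<omega> \<le> y $ k}"
      by (subst measure_distr) (auto intro!: arg_cong[where f = "measure P"] simp: mem_box_cart)
    finally show ?thesis using that by (simp add: copula_of_box)
  qed
  show "extends_copula_volume (copula_of P U) (restrict_space ?D unit_cube)"
    unfolding extends_copula_volume_def
    using cb 1 box
    by (auto intro!: prob_space_restrict_space simp: space_restrict_space sets_restrict_space)
qed

lemma is_copula_copula_of: "is_copula (copula_of P U)"
  unfolding is_copula_def
proof (intro conjI ballI allI impI)
  fix u :: "real ^ 'k" assume u: "u \<in> unit_cube"
  show "0 \<le> copula_of P U u" "copula_of P U u \<le> 1"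
    using u by (auto simp: copula_of_def)
  have m: "{\<omega> \<in> space P. \<forall>k. U k \<omega> \<le> u $ k} \<in> sets P" by measurable
  have one: "measure P {\<omega> \<in> space P. U i \<omega> \<le> u $ i} = u $ i" for i
  proof -
    have "{0..1} \<inter> {..u $ i} = {0..u $ i}" using u by (force simp: unit_cube_def)
    then show ?thesis
      using uniform_emeasure[of "{..u $ i}" i] u
      by (simp add: measure_def unit_cube_def)
  qed
  show "copula_of P U u = 0" if "\<exists>i. u $ i = 0"
  proof -
    from that obtain i where i: "u $ i = 0" by blast
    have "measure P {\<omega> \<in> space P. \<forall>k. U k \<omega> \<le> u $ k} \<le> measure P {\<omega> \<in> space P. U i \<omega> \<le> u $ i}"
      by (intro P.finite_measure_mono) (auto, measurable)
    with one[of i] i show ?thesis using u measure_nonneg[of P] by (simp add: copula_of_def order.antisym)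
  qed
  show "copula_of P U u = u $ i" if "\<forall>j. j \<noteq> i \<longrightarrow> u $ j = 1" for i
  proof -
    have "measure P {\<omega> \<in> space P. \<forall>k. U k \<omega> \<le> u $ k} = measure P {\<omega> \<in> space P. U i \<omega> \<le> u $ i}"
    proof (rule P.finite_measure_eq_AE)
      show "AE \<omega> in P. (\<omega> \<in> {\<omega> \<in> space P. \<forall>k. U k \<omega> \<le> u $ k}) = (\<omega> \<in> {\<omega> \<in> space P. U i \<omega> \<le> u $ i})"
        using uniform_AE by eventually_elim (use that in force)
    qed measurable
    with one[of i] u show ?thesis by (simp add: copula_of_def)
  qed
next
  fix x y :: "real ^ 'k"
  assume "x \<in> unit_cube" "y \<in> unit_cube" "\<forall>i. x $ i < y $ i"
  then show "0 \<le> copula_volume (copula_of P U) x y"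
    by (subst copula_of_box) auto
qed

end

end

theory Submission
  imports Defs
begin

text \<open>The law of \<open>U\<close> is carried by the hypergraph of \<open>f'\<close>, and the law of its first
  \<open>n\<close> coordinates has the same null sets as Lebesgue measure on the cube (when \<open>n = 1\<close> by
  uniformity). So an open set \<open>G\<close> is charged by the copula iff the part of the
  hypergraph in \<open>G\<close> has a projection of positive measure on the span \<open>W0\<close> of the first \<open>n\<close>
  axes, which already gives one inclusion. For the other one, an \<open>n\<close>-dimensional standard
  subspace other than \<open>W0\<close> contains one of the last \<open>m\<close> axes; if the projection on \<open>W0\<close> is null,
  then by the refinement property so is the one on that axis, and then the one on the subspace
  lies in a null cylinder.\<close>

section \<open>Lebesgue measure on standard subspaces\<close>

text \<open>A basis vector outside \<open>B\<close> that lay in \<open>span B\<close> would depend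
  on the other basis vectors. The fact recovers \<open>B\<close> from \<open>span B\<close>, as
  needed because \<open>subspace_lborel\<close> takes its product over
  \<open>Basis \<inter> W\<close>.\<close>

lemma Basis_Int_span:
  fixes B :: "'a::euclidean_space set"
  assumes "B \<subseteq> Basis"
  shows "Basis \<inter> span B = B"
proof (intro equalityI subsetI)
  fix b assume b: "b \<in> Basis \<inter> span B"
  show "b \<in> B"
  proof (rule ccontr)
    assume "b \<notin> B"
    then have "span B \<subseteq> span (Basis - {b})" using assms by (intro span_mono) auto
    with b show False using independent_Basis unfolding dependent_def by blast
  qed
qed (use assms in \<open>auto intro: span_base\<close>)

lemma orth_proj_span_inner:
  fixes x :: "'a::euclidean_space"
  assumes "B \<subseteq> Basis" "b \<in> B"
  shows "orth_proj (span B) x \<bullet> b = x \<bullet> b"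
proof -
  have "finite B" using assms finite_Basis finite_subset by blast
  moreover have "orth_proj (span B) x \<bullet> b = (\<Sum>c\<in>B. if c = b then x \<bullet> b else 0)"
    unfolding orth_proj_span_Basis[OF assms(1)] inner_sum_left
    by (intro sum.cong refl) (use assms in \<open>auto simp: inner_Basis subset_iff\<close>)
  ultimately show ?thesis using assms by simp
qed

lemma sets_subspace_lborel [simp, measurable_cong]: "sets (subspace_lborel W) = sets borel"
  by (simp add: subspace_lborel_def)

text \<open>The right-hand side only tests points of \<open>span B\<close>. Hence Borel sets that
  agree on the subspace have equal measure, and sets can be compared without first cutting them down
  to it.\<close>

lemma emeasure_subspace_lborel:
  fixes X :: "'a::euclidean_space set"
  assumes "B \<subseteq> Basis" and [measurable]: "X \<in> sets borel"
  shows "emeasure (subspace_lborel (span B)) X =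
    emeasure (\<Pi>\<^sub>M b\<in>B. lborel) {g \<in> space (\<Pi>\<^sub>M b\<in>B. lborel). (\<Sum>b\<in>B. g b *\<^sub>R b) \<in> X}"
proof -
  have "(\<lambda>g. \<Sum>b\<in>B. g b *\<^sub>R b) \<in> (\<Pi>\<^sub>M b\<in>B. lborel) \<rightarrow>\<^sub>M borel"
    by (intro borel_measurable_sum borel_measurable_scaleR measurable_const
        measurable_component_singleton[where M = "\<lambda>_. lborel", simplified]) auto
  then show ?thesis
    unfolding subspace_lborel_def Basis_Int_span[OF assms(1)]
    by (subst emeasure_distr) (auto simp: vimage_def Int_def conj_commute)
qed

text \<open>By orthonormality the coordinate along \<open>b\<close> of the sum is
  \<open>g b\<close>, so the cylinder pulls back to a product set. Factors \<open>A b\<close> of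
  infinite measure are allowed.\<close>

lemma emeasure_subspace_lborel_cylinder:
  fixes B :: "'a::euclidean_space set"
  assumes B: "B \<subseteq> Basis" and A: "\<And>b. b \<in> B \<Longrightarrow> A b \<in> sets borel"
  shows "emeasure (subspace_lborel (span B)) {y. \<forall>b\<in>B. y \<bullet> b \<in> A b} =
    (\<Prod>b\<in>B. emeasure lborel (A b))"
proof -
  have fin: "finite B" using B finite_Basis finite_subset by blast
  interpret product_sigma_finite "\<lambda>b::'a. lborel :: real measure" ..
  have inner: "(\<Sum>c\<in>B. g c *\<^sub>R c) \<bullet> b = g b" if "b \<in> B" for g b
  proof -
    have "(\<Sum>c\<in>B. g c *\<^sub>R c) \<bullet> b = (\<Sum>c\<in>B. if c = b then g b else 0)"
      unfolding inner_sum_left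
      by (intro sum.cong refl) (use B that in \<open>auto simp: inner_Basis subset_iff\<close>)
    then show ?thesis using fin that by simp
  qed
  have "{y \<in> space borel. y \<bullet> b \<in> A b} \<in> sets borel" if "b \<in> B" for b
    using A[OF that] by measurable
  then have meas: "{y. \<forall>b\<in>B. y \<bullet> b \<in> A b} \<in> sets borel"
    using sets.sets_Collect_finite_All[OF _ fin, of borel "\<lambda>b y. y \<bullet> b \<in> A b"] by simp
  have "{g \<in> space (\<Pi>\<^sub>M b\<in>B. lborel). (\<Sum>b\<in>B. g b *\<^sub>R b) \<in> {y. \<forall>b\<in>B. y \<bullet> b \<in> A b}} = Pi\<^sub>E B A"
    by (auto simp: inner space_PiM PiE_def Pi_def)
  then show ?thesis
    unfolding emeasure_subspace_lborel[OF B meas] using fin A by (simp add: emeasure_PiM)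
qed

text \<open>A null cover of the projection on the axis of \<open>b\<close> generates a cylinder that
  covers the projection on \<open>span B\<close>. Its measure is a product with a zero factor, and
  infinite factors do no harm since 0 times infinity is 0 in \<open>ennreal\<close>.\<close>

lemma subspace_outer_proj_null:
  fixes B :: "'a::euclidean_space set"
  assumes B: "B \<subseteq> Basis" and b: "b \<in> B"
    and null: "subspace_outer (span {b}) (orth_proj (span {b}) ` S) = 0"
  shows "subspace_outer (span B) (orth_proj (span B) ` S) = 0"
proof -
  have b1: "{b} \<subseteq> Basis" and bb: "b \<bullet> b = 1" using B b by (auto simp: inner_Basis)
  have fin: "finite B" using B finite_Basis finite_subset by blast
  have "orth_proj (span {b}) ` S \<subseteq> space (subspace_lborel (span {b}))"
    by (simp add: subspace_lborel_def)
  \<comment> \<open>The outer measure is attained by a Borel cover; \<open>X\<close> may reach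
    outside the axis.\<close>
  then obtain X where X: "X \<in> sets borel" "orth_proj (span {b}) ` S \<subseteq> X"
    "emeasure (subspace_lborel (span {b})) X = 0"
    using outer_measure_of_attain null unfolding subspace_outer_def by (metis sets_subspace_lborel)
  \<comment> \<open>The trace of \<open>X\<close> on the axis, read as a subset of the real
    line.\<close>
  define N where "N = (\<lambda>t. t *\<^sub>R b) -` X"
  have N: "N \<in> sets borel"
    using measurable_sets[of "\<lambda>t. t *\<^sub>R b" borel borel X] X(1) by (simp add: N_def)
  have "emeasure lborel N = emeasure (subspace_lborel (span {b})) {y. y \<bullet> b \<in> N}"
    using emeasure_subspace_lborel_cylinder[OF b1, of "\<lambda>_. N"] N by simp
  \<comment> \<open>The two sets may differ off the axis but agree on it, where the measure is
    concentrated.\<close>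
  also have "\<dots> = emeasure (subspace_lborel (span {b})) X"
  proof -
    have "{y. y \<bullet> b \<in> N} \<in> sets borel"
      using measurable_sets[of "\<lambda>y. y \<bullet> b" borel borel N] N by (simp add: vimage_def)
    then show ?thesis
      using X(1) bb by (simp add: emeasure_subspace_lborel[OF b1] N_def)
  qed
  finally have N0: "emeasure lborel N = 0" using X(3) by simp
  let ?A = "\<lambda>c. if c = b then N else UNIV"
  have "orth_proj (span B) ` S \<subseteq> {y. \<forall>c\<in>B. y \<bullet> c \<in> ?A c}"
    using X(2) B b by (auto simp: orth_proj_span_inner N_def orth_proj_span_Basis[OF b1])
  then have "subspace_outer (span B) (orth_proj (span B) ` S) \<le>
      subspace_outer (span B) {y. \<forall>c\<in>B. y \<bullet> c \<in> ?A c}"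
    unfolding subspace_outer_def by (rule outer_measure_of_mono)
  also have "\<dots> = emeasure (subspace_lborel (span B)) {y. \<forall>c\<in>B. y \<bullet> c \<in> ?A c}"
  proof -
    have "{y. \<forall>c\<in>B. y \<bullet> c \<in> ?A c} = (\<lambda>y. y \<bullet> b) -` N" using b by auto
    moreover have "(\<lambda>y. y \<bullet> b) -` N \<in> sets borel"
      using measurable_sets[of "\<lambda>y. y \<bullet> b" borel borel N] N by simp
    ultimately show ?thesis
      unfolding subspace_outer_def by (simp add: outer_measure_of_eq)
  qed
  also have "\<dots> = (\<Prod>c\<in>B. emeasure lborel (?A c))"
    using N by (intro emeasure_subspace_lborel_cylinder[OF B]) simp
  also have "\<dots> = 0" using fin b N0 by (auto intro!: prod_zero)
  finally show ?thesis by simp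
qed

section \<open>The hypergraph and its projection\<close>

text \<open>Parametrizes the hypergraph by its base point. With zero functions in place of
  \<open>f\<close> it is the embedding of \<real>^n as the span of the first n axes.\<close>

definition graph_point :: "('m::finite \<Rightarrow> real ^ 'n \<Rightarrow> real) \<Rightarrow> real ^ 'n \<Rightarrow> real ^ ('n + 'm)" where
  "graph_point f x = (\<chi> k. case k of Inl i \<Rightarrow> x $ i | Inr j \<Rightarrow> f j x)"

lemma graph_point_nth [simp]:
  "graph_point f x $ Inl i = x $ i" "graph_point f x $ Inr j = f j x"
  by (simp_all add: graph_point_def)

lemma hypergraph_eq: "hypergraph D f = graph_point f ` D"
  by (simp add: hypergraph_def graph_point_def[abs_def])

lemma unit_cube_borel [measurable]: "unit_cube \<in> sets (borel :: (real ^ 'k) measure)"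
  by (simp add: unit_cube_eq_cbox)

lemma borel_measurable_vec:
  fixes g :: "'a \<Rightarrow> real ^ 'k"
  assumes "\<And>k. (\<lambda>x. g x $ k) \<in> borel_measurable M"
  shows "g \<in> borel_measurable M"
  using assms by (subst borel_measurable_euclidean_space) (auto simp: Basis_vec_def inner_axis)

lemma borel_on_cube_measurable:
  assumes "borel_on_cube g"
  shows "g \<in> borel_measurable (restrict_space borel unit_cube)"
  using assms unfolding borel_on_cube_def measurable_restrict_space2_iff by auto

lemma graph_point_measurable:
  fixes f :: "'m::finite \<Rightarrow> real ^ 'n \<Rightarrow> real"
  assumes "\<And>j. borel_on_cube (f j)"
  shows "graph_point f \<in> borel_measurable (restrict_space borel unit_cube)"
proof (rule borel_measurable_vec)
  fix k :: "'n + 'm"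
  show "(\<lambda>x. graph_point f x $ k) \<in> borel_measurable (restrict_space borel unit_cube)"
  proof (cases k)
    case (Inl i)
    then show ?thesis
      by (auto intro!: measurable_restrict_space1 borel_measurable_continuous_onI continuous_intros)
  next
    case (Inr j)
    then show ?thesis using borel_on_cube_measurable[OF assms] by simp
  qed
qed

text \<open>This slice of base points is the link between both sides of the theorem: the mass that
  the copula gives to \<open>G\<close> and the size of the projection of the graph inside
  \<open>G\<close> are both expressed through it.\<close>

lemma graph_slice_borel:
  fixes f :: "'m::finite \<Rightarrow> real ^ 'n \<Rightarrow> real"
  assumes "\<And>j. borel_on_cube (f j)" "open G"
  shows "{x \<in> unit_cube. graph_point f x \<in> G} \<in> sets borel"
proof -
  have "graph_point f -` G \<inter> space (restrict_space borel unit_cube)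
      \<in> sets (restrict_space borel unit_cube)"
    using assms by (intro measurable_sets[OF graph_point_measurable]) auto
  then show ?thesis
    by (simp add: sets_restrict_space_iff space_restrict_space vimage_def Int_def conj_commute)
qed

section \<open>The span of the first n axes as a copy of \<real>^n\<close>

definition W0_basis :: "(real ^ ('n::finite + 'm::finite)) set" where
  "W0_basis = range (\<lambda>i. axis (Inl i) 1)"

lemma W0_basis_subset: "W0_basis \<subseteq> Basis"
  by (auto simp: W0_basis_def Basis_vec_def)

lemma inj_axis_Inl: "inj (\<lambda>i::'n::finite. axis (Inl i) (1::real) :: real ^ ('n + 'm::finite))"
  by (auto intro!: injI simp: axis_eq_axis)

lemma card_W0_basis: "card (W0_basis :: (real ^ ('n::finite + 'm::finite)) set) = CARD('n)"
  unfolding W0_basis_def using inj_axis_Inl by (rule card_image)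

lemma inner_axis_1: "(x :: real ^ 'k) \<bullet> axis k 1 = x $ k"
  by (simp add: inner_axis)

lemma borel_measurable_nth [measurable]: "(\<lambda>x :: real ^ 'k. x $ k) \<in> borel_measurable borel"
  by (intro borel_measurable_continuous_onI continuous_intros)

abbreviation left_part :: "real ^ ('n::finite + 'm::finite) \<Rightarrow> real ^ 'n" where
  "left_part y \<equiv> (\<chi> i. y $ Inl i)"

lemma left_part_measurable [measurable]: "left_part \<in> borel_measurable borel"
  by (rule borel_measurable_vec) simp

text \<open>Dropping the last m coordinates, which vanish on the subspace, identifies it with
  \<real>^n. It suffices to compare boxes, where both measures give the product of the side
  lengths.\<close>

lemma lborel_eq_distr_left_part:
  "(lborel :: (real ^ 'n::finite) measure) =
    distr (subspace_lborel (span (W0_basis :: (real ^ ('n + 'm::finite)) set))) borel left_part"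
proof (rule lborel_eqI)
  fix l u :: "real ^ 'n" assume lu: "\<And>b. b \<in> Basis \<Longrightarrow> l \<bullet> b \<le> u \<bullet> b"
  have lu': "l $ i \<le> u $ i" for i
    using lu[of "axis i 1"] by (simp add: inner_axis_1 axis_in_Basis_iff)
  \<comment> \<open>The cylinder lemma wants a family indexed by vectors. At
    \<open>b = axis (Inl i) 1\<close>, \<open>left_part b\<close> is the i-th unit vector, so
    \<open>A b\<close> is the i-th side of the box.\<close>
  define A :: "real ^ ('n + 'm) \<Rightarrow> real set" where "A b = {l \<bullet> left_part b <..< u \<bullet> left_part b}" for b
  have lp: "left_part (axis (Inl i) 1 :: real ^ ('n + 'm)) = axis i 1" for i
    by (simp add: vec_eq_iff axis_def)
  have pre: "left_part -` box l u = {y :: real ^ ('n + 'm). \<forall>b\<in>W0_basis. y \<bullet> b \<in> A b}"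
    by (auto simp: W0_basis_def A_def lp inner_axis_1 mem_box_cart)
  have "emeasure (distr (subspace_lborel (span (W0_basis :: (real ^ ('n + 'm)) set))) borel left_part) (box l u) =
      emeasure (subspace_lborel (span W0_basis)) (left_part -` box l u \<inter> (UNIV :: (real ^ ('n + 'm)) set))"
    by (subst emeasure_distr) (auto simp: subspace_lborel_def)
  also have "\<dots> = (\<Prod>b\<in>(W0_basis :: (real ^ ('n + 'm)) set). emeasure lborel (A b))"
    unfolding pre Int_UNIV_right
    by (rule emeasure_subspace_lborel_cylinder[OF W0_basis_subset]) (simp add: A_def)
  also have "\<dots> = (\<Prod>i\<in>UNIV. ennreal (u $ i - l $ i))"
    unfolding W0_basis_def
    by (subst prod.reindex[OF inj_axis_Inl]) (simp add: A_def lp inner_axis_1 lu' del: ennreal_minus)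
  also have "\<dots> = ennreal (\<Prod>i\<in>UNIV. u $ i - l $ i)" using lu' by (simp add: prod_ennreal)
  also have "(\<Prod>i\<in>UNIV. u $ i - l $ i) = (\<Prod>b\<in>Basis. (u - l) \<bullet> b)"
  proof -
    have "(Basis :: (real ^ 'n) set) = range (\<lambda>i. axis i 1)" by (auto simp: Basis_vec_def)
    moreover have "inj (\<lambda>i::'n. axis i (1::real))" by (auto intro!: injI simp: axis_eq_axis)
    ultimately have "prod h Basis = (\<Prod>i\<in>UNIV. h (axis i 1))" for h :: "real ^ 'n \<Rightarrow> real"
      by (metis (no_types, lifting) prod.reindex_cong)
    then show ?thesis by (simp only: inner_axis_1 vector_minus_component)
  qed
  finally show "emeasure (distr (subspace_lborel (span (W0_basis :: (real ^ ('n + 'm)) set))) borel left_part)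
     (box l u) = ennreal (\<Prod>b\<in>Basis. (u - l) \<bullet> b)" .
qed simp

lemma orth_proj_W0:
  fixes x :: "real ^ ('n::finite + 'm::finite)"
  shows "orth_proj (span W0_basis) x = graph_point (\<lambda>_ _. 0) (left_part x)"
proof -
  have "(\<Sum>i\<in>UNIV. x $ Inl i *\<^sub>R axis (Inl i) 1) $ k = graph_point (\<lambda>_ _. 0) (left_part x) $ k" for k
    by (cases k) (auto simp: axis_def if_distrib[of "\<lambda>t. _ * t"] cong: if_cong)
  then have "(\<Sum>i\<in>UNIV. x $ Inl i *\<^sub>R axis (Inl i) 1) = graph_point (\<lambda>_ _. 0) (left_part x)"
    unfolding vec_eq_iff by blast
  then show ?thesis
    unfolding orth_proj_span_Basis[OF W0_basis_subset] unfolding W0_basis_def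
    by (subst sum.reindex[OF inj_axis_Inl]) (simp add: inner_axis_1)
qed

text \<open>The part of the graph over a set \<open>A\<close> of base points projects onto
  \<open>A\<close> times the origin. For the Borel slice \<open>A\<close> this is a Borel set, so
  its outer measure is its measure, and \<open>left_part\<close> carries that over to
  \<real>^n.\<close>

lemma subspace_outer_W0:
  fixes f :: "'m::finite \<Rightarrow> real ^ 'n \<Rightarrow> real"
  assumes f: "\<And>j. borel_on_cube (f j)" and G: "open G"
  shows "subspace_outer (span W0_basis) (orth_proj (span W0_basis) ` (G \<inter> hypergraph unit_cube f)) =
    emeasure lborel {x \<in> unit_cube. graph_point f x \<in> G}"
proof -
  let ?W = "span (W0_basis :: (real ^ ('n + 'm)) set)"
  define A where "A = {x \<in> unit_cube. graph_point f x \<in> G}"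
  have A: "A \<in> sets borel"
    unfolding A_def by (rule graph_slice_borel[OF f G])
  have lp: "left_part (graph_point g x) = x" for g :: "'m \<Rightarrow> real ^ 'n \<Rightarrow> real" and x
    by (simp add: vec_eq_iff)
  let ?X = "{y :: real ^ ('n + 'm). left_part y \<in> A \<and> (\<forall>j. y $ Inr j = 0)}"
  have "G \<inter> hypergraph unit_cube f = graph_point f ` A"
    unfolding hypergraph_eq A_def by blast
  then have "orth_proj ?W ` (G \<inter> hypergraph unit_cube f) = graph_point (\<lambda>_ _. 0) ` A"
    by (simp only: image_image orth_proj_W0 lp)
  also have "\<dots> = ?X"
  proof (intro equalityI subsetI)
    fix y assume y: "y \<in> ?X"
    have "y $ k = graph_point (\<lambda>_ _. 0) (left_part y) $ k" for k
      using y by (cases k) auto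
    then have "y = graph_point (\<lambda>_ _. 0) (left_part y)" unfolding vec_eq_iff by blast
    with y show "y \<in> graph_point (\<lambda>_ _. 0) ` A" by blast
  qed (auto simp: lp)
  finally have img: "orth_proj ?W ` (G \<inter> hypergraph unit_cube f) = ?X" .
  have "left_part -` A \<inter> space borel \<in> sets (borel :: (real ^ ('n + 'm)) measure)"
    by (rule measurable_sets[OF left_part_measurable A])
  then have Y: "left_part -` A \<in> sets (borel :: (real ^ ('n + 'm)) measure)" by simp
  have "closed (\<Inter>j. {y :: real ^ ('n + 'm). y $ Inr j = 0})"
    by (intro closed_INT ballI closed_Collect_eq continuous_intros)
  moreover have "?X = left_part -` A \<inter> (\<Inter>j. {y. y $ Inr j = 0})" by blast
  ultimately have X: "?X \<in> sets borel" using Y by (simp only: sets.Int borel_closed)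
  \<comment> \<open>Every point of the span has vanishing last m coordinates, so this condition in
    \<open>?X\<close> costs no measure and the full cylinder over \<open>A\<close> may replace
    \<open>?X\<close>.\<close>
  have zero: "(\<Sum>b\<in>W0_basis. g b *\<^sub>R b) $ Inr j = 0" for g :: "real ^ ('n + 'm) \<Rightarrow> real" and j
    unfolding sum_component by (rule sum.neutral) (auto simp: W0_basis_def axis_def)
  have "(\<Sum>b\<in>W0_basis. g b *\<^sub>R b) \<in> ?X \<longleftrightarrow> (\<Sum>b\<in>W0_basis. g b *\<^sub>R b) \<in> left_part -` A"
    for g :: "real ^ ('n + 'm) \<Rightarrow> real"
    unfolding mem_Collect_eq vimage_eq zero by blast
  then have "emeasure (subspace_lborel ?W) ?X = emeasure (subspace_lborel ?W) (left_part -` A)"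
    unfolding emeasure_subspace_lborel[OF W0_basis_subset X]
      emeasure_subspace_lborel[OF W0_basis_subset Y] by (simp only:)
  also have "\<dots> = emeasure (distr (subspace_lborel ?W) borel left_part) A"
    using A by (subst emeasure_distr) (simp_all add: subspace_lborel_def)
  also have "\<dots> = emeasure lborel A"
    by (simp only: lborel_eq_distr_left_part[symmetric])
  finally show ?thesis
    using X unfolding img A_def[symmetric] subspace_outer_def
    by (subst outer_measure_of_eq) (simp_all only: sets_subspace_lborel)
qed

section \<open>The support\<close>

lemma emeasure_copula_measure:
  fixes U :: "'k::finite \<Rightarrow> 'a \<Rightarrow> real"
  assumes P: "prob_space P" and U: "\<And>k. uniform01_rv P (U k)"
    and A: "A \<in> sets borel" "A \<subseteq> unit_cube"
  shows "emeasure (copula_measure (copula_of P U)) A =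
    emeasure P {\<omega> \<in> space P. (\<chi> k. U k \<omega>) \<in> A}"
  unfolding copula_measure_copula_of[OF P U]
  using A joint_measurable[OF P, of U, OF U]
  by (simp add: emeasure_restrict_space emeasure_distr vimage_def Int_def conj_commute)

section \<open>The one-dimensional case and the law carried by the graph\<close>

lemma lborel_eq_distr_const_vec:
  assumes "CARD('n::finite) = 1"
  shows "(lborel :: (real ^ 'n) measure) = distr lborel borel (\<lambda>t. \<chi> i. t)"
proof (rule lborel_eqI)
  obtain a where a: "(UNIV :: 'n set) = {a}" using assms by (metis card_1_singletonE)
  fix l u :: "real ^ 'n" assume lu: "\<And>b. b \<in> Basis \<Longrightarrow> l \<bullet> b \<le> u \<bullet> b"
  have lu': "l $ a \<le> u $ a" using lu[of "axis a 1"] by (simp add: inner_axis_1 axis_in_Basis_iff)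
  have all: "(\<forall>i::'n. Q i) \<longleftrightarrow> Q a" for Q
    using a by (metis UNIV_I singletonD)
  have "Basis = {axis a (1::real)}"
    using a by (auto simp: Basis_vec_def)
  then have "(\<Prod>b\<in>Basis. (u - l) \<bullet> b) = u $ a - l $ a"
    by (metis (no_types, lifting) prod.insert finite.emptyI empty_iff prod.empty mult_1_right
        inner_axis_1 vector_minus_component)
  moreover have "(\<lambda>t. \<chi> i. t) -` box l u = {l $ a <..< u $ a}"
    by (auto simp: mem_box_cart all)
  moreover have "(\<lambda>t. (\<chi> i. t) :: real ^ 'n) \<in> borel_measurable borel"
    by (rule borel_measurable_vec) simp
  ultimately show "emeasure (distr lborel borel (\<lambda>t. \<chi> i. t)) (box l u) = ennreal (\<Prod>b\<in>Basis. (u - l) \<bullet> b)"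
    using lu' by (simp add: emeasure_distr)
qed simp

text \<open>For a single variable, uniformity alone makes the law Lebesgue measure on the cube. This
  supplies for n = 1 the mutual absolute continuity that is assumed only for n \<ge> 2.\<close>

lemma copula_measure_dim_1:
  fixes U :: "'n::finite \<Rightarrow> 'a \<Rightarrow> real"
  assumes P: "prob_space P" and U: "\<And>k. uniform01_rv P (U k)" and card: "CARD('n) = 1"
  shows "copula_measure (copula_of P U) = restrict_space lborel unit_cube"
proof (rule measure_eqI)
  show sets: "sets (copula_measure (copula_of P U)) = sets (restrict_space lborel unit_cube)"
    unfolding copula_measure_copula_of[OF P U] by (simp add: sets_restrict_space)
  obtain a where a: "(UNIV :: 'n set) = {a}" using card by (metis card_1_singletonE)
  have alla: "i = a" for i using a by blast
  fix A assume "A \<in> sets (copula_measure (copula_of P U))"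
  then have A: "A \<in> sets borel" "A \<subseteq> unit_cube"
    unfolding sets by (auto simp: sets_restrict_space_iff)
  let ?c = "\<lambda>t::real. (\<chi> i. t) :: real ^ 'n"
  have c: "?c \<in> borel_measurable borel"
    by (rule borel_measurable_vec) simp
  then have cA: "?c -` A \<in> sets borel" using A(1) measurable_sets[OF c] by simp
  have "(\<chi> k. U k \<omega>) = ?c (U a \<omega>)" for \<omega>
  proof -
    have "U k \<omega> = U a \<omega>" for k by (simp add: alla[of k])
    then show ?thesis by (simp add: vec_eq_iff)
  qed
  then have "emeasure (copula_measure (copula_of P U)) A = emeasure P {\<omega> \<in> space P. U a \<omega> \<in> ?c -` A}"
    by (simp add: emeasure_copula_measure[OF P U A])
  also have "\<dots> = emeasure lborel ({0..1} \<inter> ?c -` A)"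
    by (rule uniform_emeasure[OF P U cA])
  also have "{0..1} \<inter> ?c -` A = ?c -` A"
    using A(2) by (auto simp: unit_cube_def)
  also have "emeasure lborel (?c -` A) = emeasure (distr lborel borel ?c) A"
    using A(1) c by (simp add: emeasure_distr)
  also have "\<dots> = emeasure (restrict_space lborel unit_cube) A"
    using A unfolding lborel_eq_distr_const_vec[OF card, symmetric]
    by (simp add: emeasure_restrict_space)
  finally show "emeasure (copula_measure (copula_of P U)) A = emeasure (restrict_space lborel unit_cube) A" .
qed

text \<open>Almost surely the random vector is the graph point of \<open>f'\<close> over its first n
  coordinates, so it lies in \<open>G\<close> exactly when these coordinates lie in the slice.
  Absolute continuity allows \<open>f'\<close> in place of \<open>f\<close>: the set where they
  differ is Lebesgue null, hence the law of the first n coordinates does not charge it.\<close>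

lemma emeasure_copula_measure_graph:
  fixes U :: "'n::finite + 'm::finite \<Rightarrow> 'a \<Rightarrow> real" and f f' :: "'m \<Rightarrow> real ^ 'n \<Rightarrow> real"
  assumes P: "prob_space P" and U: "\<And>k. uniform01_rv P (U k)"
    and ac: "absolutely_continuous (restrict_space lborel (unit_cube :: (real ^ 'n) set))
        (copula_measure (copula_of P (\<lambda>i. U (Inl i))))"
    and f: "\<And>j. borel_on_cube (f j)" and f': "\<And>j. borel_on_cube (f' j)"
    and dep: "\<And>j. AE \<omega> in P. U (Inr j) \<omega> = f j (\<chi> i. U (Inl i) \<omega>)"
    and eq: "\<And>j. AE x in lborel. x \<in> unit_cube \<longrightarrow> f' j x = f j x"
    and G: "open G"
  shows "emeasure (copula_measure (copula_of P U)) (G \<inter> unit_cube) =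
    emeasure (copula_measure (copula_of P (\<lambda>i. U (Inl i)))) {x \<in> unit_cube. graph_point f' x \<in> G}"
proof -
  let ?V = "\<lambda>\<omega>. \<chi> i. U (Inl i) \<omega>"
  let ?A = "{x \<in> unit_cube. graph_point f' x \<in> G}"
  have UL: "uniform01_rv P (\<lambda>\<omega>. U (Inl i) \<omega>)" for i by (rule U)
  note mV [measurable] = joint_measurable[OF P, of "\<lambda>i. U (Inl i)", OF UL]
  note mU [measurable] = joint_measurable[OF P, of U, OF U]
  \<comment> \<open>The functions are compared only on the cube. The second alternative is excluded
    later, as uniform variables almost surely take values in [0,1].\<close>
  have agree: "AE \<omega> in P. f' j (?V \<omega>) = f j (?V \<omega>) \<or> ?V \<omega> \<notin> unit_cube" for j
  proof (rule AE_I)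
    let ?N = "{x \<in> unit_cube. f' j x \<noteq> f j x}"
    have "?N = {x \<in> space (restrict_space borel unit_cube). f' j x \<noteq> f j x}"
      by (simp add: space_restrict_space)
    also have "\<dots> \<in> sets (restrict_space borel unit_cube)"
      using borel_on_cube_measurable[OF f, of j] borel_on_cube_measurable[OF f', of j] by measurable
    finally have N: "?N \<in> sets borel" by (simp add: sets_restrict_space_iff)
    have "AE x in lborel. x \<notin> ?N" using eq[of j] by eventually_elim auto
    then have "emeasure lborel ?N = 0"
      using N by (subst (asm) AE_iff_measurable[OF _ refl]) auto
    then have "?N \<in> null_sets (restrict_space lborel unit_cube)"
      using N by (auto simp: null_sets_def emeasure_restrict_space sets_restrict_space_iff)
    then have "emeasure (copula_measure (copula_of P (\<lambda>i. U (Inl i)))) ?N = 0"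
      using ac unfolding absolutely_continuous_def by auto
    then show "emeasure P {\<omega> \<in> space P. ?V \<omega> \<in> ?N} = 0"
      using emeasure_copula_measure[OF P UL N] by auto
    show "{\<omega> \<in> space P. ?V \<omega> \<in> ?N} \<in> sets P" using N by measurable
  qed auto
  have "AE \<omega> in P. \<forall>j. U (Inr j) \<omega> = f j (?V \<omega>)"
    using dep by (simp add: AE_all_countable)
  moreover have "AE \<omega> in P. \<forall>j. f' j (?V \<omega>) = f j (?V \<omega>) \<or> ?V \<omega> \<notin> unit_cube"
    using agree by (simp only: AE_all_countable) blast
  ultimately have ae: "AE \<omega> in P. (\<chi> k. U k \<omega>) \<in> G \<inter> unit_cube \<longleftrightarrow> ?V \<omega> \<in> ?A"
    using uniform_AE[OF P, of U, OF U]
  proof eventually_elim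
    case (elim \<omega>)
    have cube: "?V \<omega> \<in> unit_cube" "(\<chi> k. U k \<omega>) \<in> unit_cube"
      using elim(3) by (auto simp: unit_cube_def)
    have "U k \<omega> = graph_point f' (?V \<omega>) $ k" for k
      using elim(1,2) cube(1) by (cases k) auto
    then have "(\<chi> k. U k \<omega>) = graph_point f' (?V \<omega>)"
      unfolding vec_eq_iff vec_lambda_beta by blast
    with cube show ?case by simp
  qed
  have A: "?A \<in> sets borel" by (rule graph_slice_borel[OF f' G])
  have "emeasure (copula_measure (copula_of P U)) (G \<inter> unit_cube) =
      emeasure P {\<omega> \<in> space P. (\<chi> k. U k \<omega>) \<in> G \<inter> unit_cube}"
    using G by (intro emeasure_copula_measure[OF P U]) auto
  also have "\<dots> = emeasure P {\<omega> \<in> space P. ?V \<omega> \<in> ?A}"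
  proof (rule emeasure_eq_AE)
    have "G \<inter> unit_cube \<in> sets borel" using G by auto
    from measurable_sets[OF mU this]
    show "{\<omega> \<in> space P. (\<chi> k. U k \<omega>) \<in> G \<inter> unit_cube} \<in> sets P"
      by (simp only: vimage_def Int_def mem_Collect_eq conj_commute)
    from measurable_sets[OF mV A]
    show "{\<omega> \<in> space P. ?V \<omega> \<in> ?A} \<in> sets P"
      by (simp only: vimage_def Int_def mem_Collect_eq conj_commute)
  qed (use ae in \<open>eventually_elim, auto\<close>)
  also have "\<dots> = emeasure (copula_measure (copula_of P (\<lambda>i. U (Inl i)))) ?A"
    using A by (subst emeasure_copula_measure[OF P UL]) auto
  finally show ?thesis .
qed

section \<open>Equality of the support and the essential closure\<close>

theorem theorem3p3p3:
  fixes P :: "'a measure"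
    and U :: "'n::finite + 'm::finite \<Rightarrow> 'a \<Rightarrow> real"
    and f f' :: "'m \<Rightarrow> real ^ 'n \<Rightarrow> real"
  assumes "prob_space P"
    and "\<And>k. uniform01_rv P (U k)"
    and "CARD('n) \<ge> 2 \<Longrightarrow>
      absolutely_continuous (copula_measure (copula_of P (\<lambda>i. U (Inl i))))
        (restrict_space lborel (unit_cube :: (real ^ 'n) set))"
    and "CARD('n) \<ge> 2 \<Longrightarrow>
      absolutely_continuous (restrict_space lborel (unit_cube :: (real ^ 'n) set))
        (copula_measure (copula_of P (\<lambda>i. U (Inl i))))"
    and "\<And>j. borel_on_cube (f j)"
    and "\<And>j. AE \<omega> in P. U (Inr j) \<omega> = f j (\<chi> i. U (Inl i) \<omega>)"
    and "borel_essential_refinement f f'"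
  shows "copula_support (copula_of P U) =
    essential_closure CARD('n) (hypergraph unit_cube f')"
proof -
  note P = assms(1) and U = assms(2)
  have UL: "uniform01_rv P (\<lambda>\<omega>. U (Inl i) \<omega>)" for i by (rule U)
  let ?L = "restrict_space lborel (unit_cube :: (real ^ 'n) set)"
  let ?V = "copula_measure (copula_of P (\<lambda>i. U (Inl i)))"
  let ?H = "hypergraph unit_cube f'"
  let ?A = "\<lambda>G. {x \<in> unit_cube. graph_point f' x \<in> G}"
  have card: "CARD('n) \<ge> 2 \<or> CARD('n) = 1"
    using zero_less_card_finite[where 'a = 'n] by linarith
  \<comment> \<open>When n = 1 the two measures coincide, so both relations are trivial.\<close>
  then have ac: "absolutely_continuous ?V ?L" "absolutely_continuous ?L ?V"
    using assms(3,4) copula_measure_dim_1[OF P, of "\<lambda>i. U (Inl i)", OF UL]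
    by (auto simp: absolutely_continuous_def)
  have f': "borel_on_cube (f' j)" and eq: "AE x in lborel. x \<in> unit_cube \<longrightarrow> f' j x = f j x" for j
    using assms(7) by (auto simp: borel_essential_refinement_def)
  have refine: "subspace_outer (span {axis (Inr j) 1}) (orth_proj (span {axis (Inr j) 1}) ` (G \<inter> ?H)) = 0"
    if "open G" "subspace_outer (span W0_basis) (orth_proj (span W0_basis) ` (G \<inter> ?H)) = 0" for G j
    using assms(7) that unfolding borel_essential_refinement_def Let_def W0_basis_def by blast
  \<comment> \<open>The left side says that the slice \<open>?A G\<close> is charged by
    \<open>?V\<close>, the right side that it is charged by Lebesgue measure. Equality of null sets
    makes these equivalent.\<close>
  have pos: "0 < emeasure (copula_measure (copula_of P U)) (G \<inter> unit_cube) \<longleftrightarrow>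
      0 < subspace_outer (span W0_basis) (orth_proj (span W0_basis) ` (G \<inter> ?H))" if G: "open G" for G
  proof -
    have A: "?A G \<in> sets borel" by (rule graph_slice_borel[OF f' G])
    have "?A G \<in> sets ?L" using A by (auto simp: sets_restrict_space_iff)
    moreover from this have "?A G \<in> sets ?V"
      unfolding copula_measure_copula_of[OF P, of "\<lambda>i. U (Inl i)", OF UL]
      by (simp add: sets_restrict_space)
    ultimately have "emeasure ?V (?A G) = 0 \<longleftrightarrow> emeasure ?L (?A G) = 0"
      using ac unfolding absolutely_continuous_def null_sets_def by blast
    moreover have "emeasure ?L (?A G) = emeasure lborel (?A G)"
      using A by (intro emeasure_restrict_space) auto
    ultimately show ?thesis
      unfolding emeasure_copula_measure_graph[OF P U ac(2) assms(5) f' assms(6) eq G]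
        subspace_outer_W0[OF f' G]
      by (simp add: zero_less_iff_neq_zero)
  qed
  have reduce: "0 < subspace_outer (span W0_basis) (orth_proj (span W0_basis) ` (G \<inter> ?H))"
    if G: "open G" and W: "standard_subspace W" "dim W = CARD('n)"
      and W_pos: "0 < subspace_outer W (orth_proj W ` (G \<inter> ?H))" for G and W :: "(real ^ ('n + 'm)) set"
  proof (rule ccontr)
    assume "\<not> ?thesis"
    then have null: "subspace_outer (span W0_basis) (orth_proj (span W0_basis) ` (G \<inter> ?H)) = 0"
      by (simp add: zero_less_iff_neq_zero)
    from W(1) obtain B where B: "B \<subseteq> Basis" and WB: "W = span B"
      by (auto simp: standard_subspace_def)
    have "independent B" using B independent_Basis independent_mono by blast
    then have cB: "card B = CARD('n)" using W(2) WB dim_eq_card_independent by (metis dim_span)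
    show False
    \<comment> \<open>Both sets have n elements, so inclusion forces equality. Otherwise
      \<open>B\<close> contains one of the last m axis vectors, and the refinement property makes
      the projection on that axis null.\<close>
    proof (cases "B \<subseteq> W0_basis")
      case True
      have "finite (W0_basis :: (real ^ ('n + 'm)) set)" by (simp add: W0_basis_def)
      then have "B = W0_basis" using True cB card_W0_basis by (metis card_subset_eq)
      with null W_pos WB show False by simp
    next
      case False
      then obtain b where b: "b \<in> B" "b \<notin> W0_basis" by blast
      then obtain k where k: "b = axis k 1" using B by (auto simp: Basis_vec_def)
      with b(2) obtain j where "b = axis (Inr j) 1"
        by (cases k) (auto simp: W0_basis_def)
      then have "subspace_outer (span B) (orth_proj (span B) ` (G \<inter> ?H)) = 0"
        using subspace_outer_proj_null[OF B b(1)] refine[OF G null] by blast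
      with W_pos WB show False by simp
    qed
  qed
  have W0: "standard_subspace (span (W0_basis :: (real ^ ('n + 'm)) set))"
    "dim (span (W0_basis :: (real ^ ('n + 'm)) set)) = CARD('n)"
  proof -
    show "standard_subspace (span (W0_basis :: (real ^ ('n + 'm)) set))"
      using W0_basis_subset unfolding standard_subspace_def by blast
    have "independent (W0_basis :: (real ^ ('n + 'm)) set)"
      using W0_basis_subset independent_Basis independent_mono by blast
    then show "dim (span (W0_basis :: (real ^ ('n + 'm)) set)) = CARD('n)"
      by (simp add: dim_eq_card_independent card_W0_basis)
  qed
  \<comment> \<open>By \<open>reduce\<close> the existential choice of a subspace in the closure can
    always be replaced by the span of the first n axes.\<close>
  have closure_iff: "x \<in> essential_closure CARD('n) ?H \<longleftrightarrow>
      (\<forall>G. open G \<and> x \<in> G \<longrightarrow> 0 < subspace_outer (span W0_basis) (orth_proj (span W0_basis) ` (G \<inter> ?H)))" for x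
    unfolding essential_closure_def using W0 reduce by blast
  \<comment> \<open>The closure is taken in the whole space, the support only inside the cube.
    Testing with the open complement of the cube would give the empty set positive mass.\<close>
  have in_cube: "x \<in> unit_cube"
    if x: "\<forall>G. open G \<and> x \<in> G \<longrightarrow> 0 < subspace_outer (span W0_basis) (orth_proj (span W0_basis) ` (G \<inter> ?H))" for x
  proof (rule ccontr)
    assume "x \<notin> unit_cube"
    moreover have "open (- unit_cube :: (real ^ ('n + 'm)) set)"
      by (simp add: unit_cube_eq_cbox open_Compl closed_cbox)
    ultimately have "0 < emeasure (copula_measure (copula_of P U)) (- unit_cube \<inter> unit_cube)"
      using x pos by blast
    then show False by simp
  qed
  show ?thesis
  proof (rule set_eqI)
    fix x
    have "x \<in> copula_support (copula_of P U) \<longleftrightarrow> x \<in> unit_cube \<and>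
        (\<forall>G. open G \<and> x \<in> G \<longrightarrow> 0 < subspace_outer (span W0_basis) (orth_proj (span W0_basis) ` (G \<inter> ?H)))"
      unfolding copula_support_def mem_Collect_eq by (metis pos)
    then show "x \<in> copula_support (copula_of P U) \<longleftrightarrow> x \<in> essential_closure CARD('n) ?H"
      unfolding closure_iff using in_cube[of x] by argo
  qed
qed

end
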